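(* Let $\mathcal X\subseteq\mathbb R^d$, let $V\in\mathbb R^{d\times d}$ be a positive semidefinite matrix, and let $n_0'\ge1$. Let $$\mathcal F=\{x\mapsto\beta_0+\beta^Tx:\ \beta_0\in\mathbb R,\ \beta\in\mathbb R^d\},\qquad \|x\mapsto\beta_0+\beta^Tx\|=\sqrt{\beta^TV\beta+\beta_0^2},$$ and $\|f\|=\infty$ otherwise. Then optimal mean-matched sampling (OMMS) of $n_0'$ subjects from the control sample, with respect to the discrepancy $$M_V(W)=\Bigl\|V^{1/2}\Bigl(\frac1{n_1}\sum_{i\in\mathcal T_1}X_i-\sum_{i\in\mathcal T_0}W_iX_i\Bigr)\Bigr\|_2,$$ with or without replacement, is error-dual-norm minimizing (EDNM) with $(\mathcal F,\|\cdot\|)$ and with $\mathcal W_0=\mathcal W_0^{n_0'\text{-multisubset}}$ if with replacement, respectively $\mathcal W_0=\mathcal W_0^{n_0'\text{-subset}}$ if without replacement.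
   Context: Data: covariates $X=(X_1,\dots,X_n)$ with $X_i\in\mathcal X$ and treatment indicators $T\in\{0,1\}^n$; $\mathcal T_t=\{i:T_i=t\}$, $n_t=|\mathcal T_t|\ge1$. The space of allowable weights is $\mathcal W=\mathcal W_0\times\mathcal W_1$: a weight vector $W\in\mathcal W$ always has $W_i=1/n_1$ for $i\in\mathcal T_1$ and $W_{\mathcal T_0}=(W_i)_{i\in\mathcal T_0}\in\mathcal W_0$. Here, with $\mathcal W_0^{\text{probability}}=\{w\in\mathbb R_+^{\mathcal T_0}:\sum_{i\in\mathcal T_0}w_i=1\}$, one puts $\mathcal W_0^{m\text{-subset}}=\mathcal W_0^{\text{probability}}\cap\{0,1/m\}^{\mathcal T_0}$ and $\mathcal W_0^{m\text{-multisubset}}=\mathcal W_0^{\text{probability}}\cap\{0,1/m,2/m,\dots\}^{\mathcal T_0}$. The error operator is $\mathcal E(W;f)=\frac1{n_1}\sum_{i\in\mathcal T_1}f(X_i)-\sum_{i\in\mathcal T_0}W_if(X_i)$, which is invariant under adding constants to $f$. Given a space $\mathcal F$ of functions $\mathcal X\to\mathbb R$ with (semi)norm $\|\cdot\|$, put $\mathfrak E(W;\mathcal F)=\sup_{f\in\mathcal F,\ \|f\|\le1}\mathcal E(W;f)$ (the dual norm of the error). $\mathcal F/\mathbb R$ is the space of classes $[f]=\{f+c:c\in\mathbb R\}$ with norm $\|[f]\|=\min_{c\in\mathbb R}\|f+c\|$, and $\mathcal E(W;[f])=\mathcal E(W;f)$. EDNM: a matching method $W(T,X)$ is EDNM with $(\mathcal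 F,\|\cdot\|)$ and $\mathcal W$ if $\mathcal F/\mathbb R$ is a Banach space, $f\mapsto\mathcal E(W;f)$ is a continuous map from it to $\mathbb R$ for each $W\in\mathcal W$, and $$W(T,X)\in\operatorname{argmin}_{W\in\mathcal W}\mathfrak E(W;\mathcal F)\ne\mathcal W,$$ i.e. $W(T,X)$ is a minimizer and the set of minimizers is not all of $\mathcal W$. OMMS selects a subset (without replacement) or multisubset (with replacement) of $n_0'$ control subjects, each selected copy receiving weight $1/n_0'$, so as to minimize $M_V(W)$. The matrix $V$ is usually taken to be the (pseudo)inverse of the sample covariance matrix of the covariates of the control subjects.
   Formalization: The norm uses the pseudoinverse of V in place of V, with β restricted to the range of V, since as printed the claim fails (e.g. V = diag(1,4)); and M_V is assumed not constant on the candidate samples, since otherwise the set of minimizers is all of W. *)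

theory Defs
  imports "HOL-Analysis.Analysis"
begin

section \<open>Treatment groups and allowable weights\<close>

text \<open>The subjects are the elements of the finite index type \<open>'n\<close>.\<close>

definition treatment_group :: "('n::finite \<Rightarrow> nat) \<Rightarrow> nat \<Rightarrow> 'n set" where
  "treatment_group T t = {i. T i = t}"

text \<open>Vectors indexed by the control group are represented by extensional functions.\<close>

definition prob_weights :: "'n set \<Rightarrow> ('n \<Rightarrow> real) set" where
  "prob_weights I = {w \<in> I \<rightarrow>\<^sub>E {0..}. (\<Sum>i\<in>I. w i) = 1}"

definition subset_weights :: "nat \<Rightarrow> 'n set \<Rightarrow> ('n \<Rightarrow> real) set" where
  "subset_weights m I = prob_weights I \<inter> (I \<rightarrow>\<^sub>E {0, 1 / real m})"

definition multisubset_weights :: "nat \<Rightarrow> 'n set \<Rightarrow> ('n \<Rightarrow> real) set" where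
  "multisubset_weights m I = prob_weights I \<inter> (I \<rightarrow>\<^sub>E range (\<lambda>k::nat. real k / real m))"

definition allowable_weights ::
    "('n::finite \<Rightarrow> nat) \<Rightarrow> ('n \<Rightarrow> real) set \<Rightarrow> ('n \<Rightarrow> real) set" where
  "allowable_weights T W0 =
     {W. (\<forall>i\<in>treatment_group T 1. W i = 1 / real (card (treatment_group T 1)))
       \<and> restrict W (treatment_group T 0) \<in> W0}"


section \<open>The error operator and its dual norm\<close>

definition matching_error ::
    "('n::finite \<Rightarrow> nat) \<Rightarrow> ('n \<Rightarrow> 'x) \<Rightarrow> ('n \<Rightarrow> real) \<Rightarrow> ('x \<Rightarrow> real) \<Rightarrow> real" where
  "matching_error T X W f =
     (1 / real (card (treatment_group T 1))) * (\<Sum>i\<in>treatment_group T 1. f (X i))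
       - (\<Sum>i\<in>treatment_group T 0. W i * f (X i))"

text \<open>The supremum is taken in the extended reals, so that an unbounded error has dual
  norm \<open>\<infinity>\<close>.\<close>

definition error_dual_norm ::
    "('x \<Rightarrow> real) set \<Rightarrow> (('x \<Rightarrow> real) \<Rightarrow> ereal) \<Rightarrow>
     ('n::finite \<Rightarrow> nat) \<Rightarrow> ('n \<Rightarrow> 'x) \<Rightarrow> ('n \<Rightarrow> real) \<Rightarrow> ereal" where
  "error_dual_norm F N T X W = (SUP f\<in>{f \<in> F. N f \<le> 1}. ereal (matching_error T X W f))"


section \<open>The quotient by the constants\<close>

text \<open>Functions on a set \<open>D\<close> are extensional, so that equality in \<open>F\<close> is equality on \<open>D\<close>.\<close>

definition function_space :: "'x set \<Rightarrow> ('x \<Rightarrow> real) set \<Rightarrow> bool" where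
  "function_space D F \<longleftrightarrow>
     F \<subseteq> extensional D
   \<and> (\<forall>c. (\<lambda>x\<in>D. c) \<in> F)
   \<and> (\<forall>f\<in>F. \<forall>g\<in>F. (\<lambda>x\<in>D. f x + g x) \<in> F)
   \<and> (\<forall>a. \<forall>f\<in>F. (\<lambda>x\<in>D. a * f x) \<in> F)"

definition seminorm_on ::
    "'x set \<Rightarrow> ('x \<Rightarrow> real) set \<Rightarrow> (('x \<Rightarrow> real) \<Rightarrow> ereal) \<Rightarrow> bool" where
  "seminorm_on D F N \<longleftrightarrow>
     (\<forall>f\<in>F. 0 \<le> N f \<and> N f < \<infinity>)
   \<and> (\<forall>f\<in>F. \<forall>g\<in>F. N (\<lambda>x\<in>D. f x + g x) \<le> N f + N g)
   \<and> (\<forall>a. \<forall>f\<in>F. N (\<lambda>x\<in>D. a * f x) = ereal \<bar>a\<bar> * N f)"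

definition const_class :: "'x set \<Rightarrow> ('x \<Rightarrow> real) \<Rightarrow> ('x \<Rightarrow> real) set" where
  "const_class D f = range (\<lambda>c. \<lambda>x\<in>D. f x + c)"

definition mod_const :: "'x set \<Rightarrow> ('x \<Rightarrow> real) set \<Rightarrow> ('x \<Rightarrow> real) set set" where
  "mod_const D F = const_class D ` F"

text \<open>The infimum equals the minimum over the class whenever the latter is attained.\<close>

definition class_norm :: "(('x \<Rightarrow> real) \<Rightarrow> ereal) \<Rightarrow> ('x \<Rightarrow> real) set \<Rightarrow> ereal" where
  "class_norm N A = (INF f\<in>A. N f)"

definition class_diff ::
    "'x set \<Rightarrow> ('x \<Rightarrow> real) set \<Rightarrow> ('x \<Rightarrow> real) set \<Rightarrow> ('x \<Rightarrow> real) set" where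
  "class_diff D A B = {(\<lambda>x\<in>D. f x - g x) | f g. f \<in> A \<and> g \<in> B}"

text \<open>The metric of the quotient norm. The value outside the carrier is irrelevant, but the
  locale \<^locale>\<open>Metric_space\<close> asks for symmetry and nonnegativity there as well.\<close>

definition class_dist ::
    "'x set \<Rightarrow> ('x \<Rightarrow> real) set \<Rightarrow> (('x \<Rightarrow> real) \<Rightarrow> ereal) \<Rightarrow>
     ('x \<Rightarrow> real) set \<Rightarrow> ('x \<Rightarrow> real) set \<Rightarrow> real" where
  "class_dist D F N A B =
     (if A \<in> mod_const D F \<and> B \<in> mod_const D F
      then real_of_ereal (class_norm N (class_diff D A B)) else 0)"

text \<open>A seminorm on \<open>F\<close> induces a seminorm on the quotient. It is a norm iff its distance
  function satisfies the axioms of a metric, and the quotient is then a Banach space iff this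
  metric is complete.\<close>

definition banach_mod_const ::
    "'x set \<Rightarrow> ('x \<Rightarrow> real) set \<Rightarrow> (('x \<Rightarrow> real) \<Rightarrow> ereal) \<Rightarrow> bool" where
  "banach_mod_const D F N \<longleftrightarrow>
     function_space D F \<and> seminorm_on D F N
   \<and> Metric_space (mod_const D F) (class_dist D F N)
   \<and> Metric_space.mcomplete (mod_const D F) (class_dist D F N)"

text \<open>The error is the same for all members of a class, so \<^const>\<open>the_elem\<close> picks this value.\<close>

definition class_error ::
    "('n::finite \<Rightarrow> nat) \<Rightarrow> ('n \<Rightarrow> 'x) \<Rightarrow> ('n \<Rightarrow> real) \<Rightarrow> ('x \<Rightarrow> real) set \<Rightarrow> real" where
  "class_error T X W A = the_elem (matching_error T X W ` A)"


section \<open>Error-dual-norm minimizing weights\<close>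

definition minimizers :: "('w \<Rightarrow> 'a::ord) \<Rightarrow> 'w set \<Rightarrow> 'w set" where
  "minimizers h A = {W. is_arg_min h (\<lambda>W. W \<in> A) W}"

text \<open>\<open>W\<close> is the value of the matching method at the data \<open>(T, X)\<close>.\<close>

definition EDNM ::
    "'x set \<Rightarrow> ('x \<Rightarrow> real) set \<Rightarrow> (('x \<Rightarrow> real) \<Rightarrow> ereal) \<Rightarrow> ('n \<Rightarrow> real) set \<Rightarrow>
     ('n::finite \<Rightarrow> nat) \<Rightarrow> ('n \<Rightarrow> 'x) \<Rightarrow> ('n \<Rightarrow> real) \<Rightarrow> bool" where
  "EDNM D F N \<W> T X W \<longleftrightarrow>
     banach_mod_const D F N
   \<and> (\<forall>W'\<in>\<W>. continuous_map
          (Metric_space.mtopology (mod_const D F) (class_dist D F N))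
          euclideanreal (class_error T X W'))
   \<and> W \<in> minimizers (error_dual_norm F N T X) \<W>
   \<and> minimizers (error_dual_norm F N T X) \<W> \<noteq> \<W>"


section \<open>Positive semidefinite matrices\<close>

definition pos_semidef :: "real ^ 'd ^ 'd \<Rightarrow> bool" where
  "pos_semidef V \<longleftrightarrow> transpose V = V \<and> (\<forall>x. 0 \<le> x \<bullet> (V *v x))"

text \<open>A positive semidefinite matrix has exactly one positive semidefinite square root.\<close>

definition psd_sqrt :: "real ^ 'd ^ 'd \<Rightarrow> real ^ 'd ^ 'd" where
  "psd_sqrt V = (THE S. pos_semidef S \<and> S ** S = V)"

text \<open>The Moore--Penrose inverse; it equals \<^const>\<open>matrix_inv\<close> on invertible matrices.\<close>

definition pseudo_inv :: "real ^ 'd ^ 'd \<Rightarrow> real ^ 'd ^ 'd" where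
  "pseudo_inv V = (THE P. V ** P ** V = V \<and> P ** V ** P = P
     \<and> transpose (V ** P) = V ** P \<and> transpose (P ** V) = P ** V)"


section \<open>The space of affine functions\<close>

text \<open>
  The mean discrepancy weighted by \<open>V\<close> is dual to the norm
  \<open>sqrt (\<beta> \<bullet> V\<^sup>- \<beta> + \<beta>\<^sub>0\<^sup>2)\<close> on the affine functions, where \<open>V\<^sup>-\<close> is the (pseudo-)inverse:
  by Cauchy--Schwarz the supremum of \<open>\<beta> \<bullet> z\<close> over \<open>\<beta> \<bullet> V\<^sup>- \<beta> \<le> 1\<close> is the norm of \<open>V\<^sup>1\<^sup>/\<^sup>2 z\<close>.
  With \<open>V\<close> in place of \<open>V\<^sup>-\<close> the supremum would be the norm of \<open>V\<^sup>-\<^sup>1\<^sup>/\<^sup>2 z\<close>, which has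
  different minimizers.
  A coefficient \<open>\<beta>\<close> outside the range of \<open>V\<close> gets norm \<open>\<infinity>\<close>, so it is excluded from the
  space; there are no such coefficients if \<open>V\<close> is invertible.
\<close>

definition affine_functions :: "real ^ 'd ^ 'd \<Rightarrow> (real ^ 'd) set \<Rightarrow> (real ^ 'd \<Rightarrow> real) set" where
  "affine_functions V D =
     {(\<lambda>x\<in>D. b0 + b \<bullet> x) | b0 b. b \<in> range ((*v) V)}"

text \<open>If \<open>D\<close> lies in a proper affine subspace, a function on \<open>D\<close> may have several coefficient
  pairs; the infimum selects the smallest value. If the pair is unique, the infimum is over one
  element. The infimum over the empty set is \<open>\<infinity>\<close>.\<close>

definition affine_norm ::
    "real ^ 'd ^ 'd \<Rightarrow> (real ^ 'd) set \<Rightarrow> (real ^ 'd \<Rightarrow> real) \<Rightarrow> ereal" where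
  "affine_norm V D f =
     (INF (b0, b) \<in> {(b0, b). b \<in> range ((*v) V) \<and> f = (\<lambda>x\<in>D. b0 + b \<bullet> x)}.
        ereal (sqrt (b \<bullet> (pseudo_inv V *v b) + b0\<^sup>2)))"


section \<open>Optimal mean-matched sampling\<close>

definition mean_discrepancy ::
    "real ^ 'd ^ 'd \<Rightarrow> ('n::finite \<Rightarrow> nat) \<Rightarrow> ('n \<Rightarrow> real ^ 'd) \<Rightarrow> ('n \<Rightarrow> real) \<Rightarrow> real" where
  "mean_discrepancy V T X W =
     norm (psd_sqrt V *v
       ((1 / real (card (treatment_group T 1))) *\<^sub>R (\<Sum>i\<in>treatment_group T 1. X i)
         - (\<Sum>i\<in>treatment_group T 0. W i *\<^sub>R X i)))"

definition sample_weights :: "nat \<Rightarrow> ('n::finite \<Rightarrow> nat) \<Rightarrow> 'n multiset \<Rightarrow> 'n \<Rightarrow> real" where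
  "sample_weights m T K i =
     (if i \<in> treatment_group T 1 then 1 / real (card (treatment_group T 1))
      else real (count K i) / real m)"

definition samples_with_replacement :: "nat \<Rightarrow> ('n::finite \<Rightarrow> nat) \<Rightarrow> 'n multiset set" where
  "samples_with_replacement m T = {K. size K = m \<and> set_mset K \<subseteq> treatment_group T 0}"

definition samples_without_replacement :: "nat \<Rightarrow> ('n::finite \<Rightarrow> nat) \<Rightarrow> 'n multiset set" where
  "samples_without_replacement m T =
     mset_set ` {S. S \<subseteq> treatment_group T 0 \<and> card S = m}"

text \<open>\<open>W\<close> is the weight vector of a sample from \<open>\<S>\<close> whose mean discrepancy is minimal.\<close>

definition OMMS ::
    "real ^ 'd ^ 'd \<Rightarrow> nat \<Rightarrow> 'n multiset set \<Rightarrow>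
     ('n::finite \<Rightarrow> nat) \<Rightarrow> ('n \<Rightarrow> real ^ 'd) \<Rightarrow> ('n \<Rightarrow> real) \<Rightarrow> bool" where
  "OMMS V m \<S> T X W \<longleftrightarrow>
     W \<in> minimizers (mean_discrepancy V T X) (sample_weights m T ` \<S>)"

end

theory Submission
  imports Defs
begin

text \<open>
  Let \<open>S\<close> be the positive semidefinite square root of \<open>V\<close>. Substituting \<open>\<beta> = S c\<close> with
  \<open>c\<close> in the range of \<open>S\<close> turns \<open>\<beta>\<^sub>0 + \<beta> \<bullet> x\<close> into \<open>\<beta>\<^sub>0 + c \<bullet> S x\<close> and the norm into
  the Euclidean norm of \<open>(\<beta>\<^sub>0, c)\<close>. The error of such a function is \<open>c \<bullet> S z\<close>, where \<open>z\<close> is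
  the difference of the weighted means, so by Cauchy--Schwarz the dual norm of the error is
  \<open>\<parallel>S z\<parallel>\<close>, the mean discrepancy. The quotient by the constants is isometric to the span of
  the differences \<open>S x - S y\<close>, a closed subspace of Euclidean space, hence complete.
\<close>

section \<open>Spectral decomposition of symmetric matrices\<close>

text \<open>The quadratic form \<open>x \<bullet> f x\<close> attains its maximum on the compact
  unit sphere of \<open>U\<close>; a maximizer is an eigenvector, and the maximum is its
  eigenvalue.\<close>

lemma invariant_subspace_eigenvector:
  fixes f :: "'a::euclidean_space \<Rightarrow> 'a"
  assumes "linear f" and sym: "\<And>x y. x \<bullet> f y = f x \<bullet> y"
    and U: "subspace U" "f ` U \<subseteq> U" "U \<noteq> {0}"
  obtains v l where "v \<in> U" "norm v = 1" "f v = l *\<^sub>R v"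
proof -
  interpret linear f by fact
  define K where "K = sphere 0 1 \<inter> U"
  have "compact K"
    unfolding K_def by (intro compact_Int_closed closed_subspace U compact_sphere)
  obtain u where "u \<in> U" "u \<noteq> 0" using U subspace_0 by blast
  then have "u /\<^sub>R norm u \<in> K" using U by (simp add: K_def subspace_scale)
  then have "K \<noteq> {}" by blast
  have cont: "continuous_on K (\<lambda>x. x \<bullet> f x)"
    by (intro continuous_intros linear_continuous_on linear_conv_bounded_linear[THEN iffD1] assms(1))
  obtain v where v: "v \<in> K" and max: "\<And>y. y \<in> K \<Longrightarrow> y \<bullet> f y \<le> v \<bullet> f v"
    using continuous_attains_sup[OF \<open>compact K\<close> \<open>K \<noteq> {}\<close> cont] by blast
  define l where "l = v \<bullet> f v"
  text \<open>The form \<open>q\<close> is nonnegative and vanishes at \<open>v\<close>, so its derivative at \<open>v\<close> in the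
    direction \<open>w = f v - l v\<close>, which is \<open>- 2 (w \<bullet> w)\<close>, is zero.\<close>
  define q where "q x = l * (x \<bullet> x) - x \<bullet> f x" for x
  have q_nonneg: "0 \<le> q y" if "y \<in> U" for y
  proof (cases "y = 0")
    case False
    with that have "y /\<^sub>R norm y \<in> K" using U by (simp add: K_def subspace_scale)
    from max[OF this] have "(y \<bullet> f y) / (norm y)\<^sup>2 \<le> l"
      by (simp add: l_def scale power2_eq_square divide_simps)
    with False show ?thesis by (simp add: q_def divide_simps power2_norm_eq_inner)
  qed (simp add: q_def zero)
  have vU: "v \<in> U" and nv: "norm v = 1" using v by (auto simp: K_def)
  then have vv: "v \<bullet> v = 1" by (simp add: norm_eq_1)
  define w where "w = f v - l *\<^sub>R v"
  have wU: "w \<in> U" using vU U by (auto simp: w_def intro!: subspace_diff subspace_scale)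
  define a where "a = w \<bullet> w"
  have expand: "q (v + t *\<^sub>R w) = t\<^sup>2 * q w - 2 * t * a" for t
  proof -
    have "v \<bullet> f w = f v \<bullet> w" "w \<bullet> f v = f v \<bullet> w"
      using sym[of v w] by (simp_all add: inner_commute)
    moreover have "f v \<bullet> w = a + l * (v \<bullet> w)"
      unfolding a_def by (subst w_def) (simp add: inner_diff_left)
    ultimately show ?thesis
      using vv by (simp add: q_def add scale inner_add_left inner_add_right l_def[symmetric]
          inner_commute[of w v] power2_eq_square algebra_simps)
  qed
  have nonneg: "0 \<le> t\<^sup>2 * q w - 2 * t * a" for t
    using q_nonneg[of "v + t *\<^sub>R w"] vU wU U by (simp add: expand subspace_add subspace_scale)
  have "a = 0"
  proof (cases "q w = 0")
    case True
    with nonneg[of 1] have "a \<le> 0" by simp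
    then show ?thesis unfolding a_def using inner_ge_zero[of w] by linarith
  next
    case False
    then have "0 < q w" using q_nonneg[OF wU] by simp
    \<comment> \<open>The choice \<open>t = a / q w\<close> minimizes the quadratic in
      \<open>t\<close>; its value there is \<open>- (a * a) / q w\<close>.\<close>
    with nonneg[of "a / q w"] have "a\<^sup>2 \<le> 0" by (simp add: power2_eq_square divide_simps)
    then show ?thesis by simp
  qed
  then have "f v = l *\<^sub>R v" by (simp add: a_def w_def)
  with vU nv show ?thesis using that by blast
qed

text \<open>Induction on the dimension: a unit eigenvector \<open>v\<close> is split off. By
  symmetry \<open>v \<bullet> f x = l * (v \<bullet> x)\<close>, so the orthogonal complement of
  \<open>v\<close> in \<open>U\<close> is invariant again.\<close>

lemma orthonormal_eigenbasis:
  fixes f :: "'a::euclidean_space \<Rightarrow> 'a"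
  assumes "linear f" and sym: "\<And>x y. x \<bullet> f y = f x \<bullet> y"
    and "subspace U" "f ` U \<subseteq> U"
  shows "\<exists>B. pairwise orthogonal B \<and> span B = U \<and> (\<forall>b\<in>B. norm b = 1 \<and> (\<exists>l. f b = l *\<^sub>R b))"
  using assms(3,4)
proof (induction "dim U" arbitrary: U rule: less_induct)
  case less
  note U = less.prems
  show ?case
  proof (cases "U = {0}")
    case True
    then show ?thesis by (intro exI[of _ "{}"]) auto
  next
    case False
    obtain v l where v: "v \<in> U" "norm v = 1" "f v = l *\<^sub>R v"
      using invariant_subspace_eigenvector[OF assms(1,2) U False] by blast
    have vv: "v \<bullet> v = 1" using v by (simp add: norm_eq_1)
    define U' where "U' = U \<inter> {x. v \<bullet> x = 0}"
    have U': "subspace U'"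
      unfolding U'_def by (intro subspace_inter U subspace_hyperplane)
    have "f ` U' \<subseteq> U'"
    proof
      fix y assume "y \<in> f ` U'"
      then obtain x where x: "x \<in> U" "v \<bullet> x = 0" "y = f x" by (auto simp: U'_def)
      then show "y \<in> U'" using U v sym[of v x] by (auto simp: U'_def)
    qed
    moreover have "dim U' < dim U"
    proof (rule dim_psubset)
      have "v \<notin> U'" using vv by (simp add: U'_def)
      then have "U' \<subset> U" using v(1) unfolding U'_def by blast
      then show "span U' \<subset> span U"
        using U U' by (simp add: span_eq_iff[THEN iffD2])
    qed
    ultimately obtain B where B: "pairwise orthogonal B" "span B = U'"
        "\<forall>b\<in>B. norm b = 1 \<and> (\<exists>l. f b = l *\<^sub>R b)"
      using less.hyps[OF _ U'] by blast
    have BU': "B \<subseteq> U'" using B(2) span_superset by blast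
    have "pairwise orthogonal (insert v B)"
      using B(1) BU' by (auto simp: pairwise_insert U'_def orthogonal_def inner_commute)
    moreover have "span (insert v B) = U"
    proof (rule antisym)
      show "span (insert v B) \<subseteq> U"
        using v BU' U by (intro span_minimal) (auto simp: U'_def)
      show "U \<subseteq> span (insert v B)"
      proof
        fix x assume "x \<in> U"
        then have "x - (v \<bullet> x) *\<^sub>R v \<in> U'"
          using v U vv by (auto simp: U'_def inner_diff_right intro!: subspace_diff subspace_scale)
        then show "x \<in> span (insert v B)"
          unfolding span_insert using B(2) by blast
      qed
    qed
    ultimately show ?thesis using v B(3) by (intro exI[of _ "insert v B"]) auto
  qed
qed

section \<open>Symmetric matrices: eigenbases, square roots and pseudo-inverses\<close>

lemma inner_matrix_vector_symmetric:
  fixes A :: "real ^ 'd ^ 'd"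
  assumes "transpose A = A"
  shows "x \<bullet> (A *v y) = (A *v x) \<bullet> y"
proof -
  have "x \<bullet> (A *v y) = (transpose A *v x) \<bullet> y" by (simp add: dot_lmul_matrix)
  then show ?thesis by (simp only: assms)
qed

lemma symmetric_matrix_eigenbasis:
  fixes A :: "real ^ 'd ^ 'd"
  assumes "transpose A = A"
  obtains B l where "finite B" "pairwise orthogonal B" "\<And>b. b \<in> B \<Longrightarrow> norm b = 1" "span B = UNIV"
    "\<And>b. b \<in> B \<Longrightarrow> A *v b = l b *\<^sub>R b"
proof -
  obtain B where B: "pairwise orthogonal B" "span B = UNIV"
      "\<forall>b\<in>B. norm b = 1 \<and> (\<exists>l. A *v b = l *\<^sub>R b)"
    using orthonormal_eigenbasis[of "(*v) A" UNIV] inner_matrix_vector_symmetric[OF assms]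
    by (metis matrix_vector_mul_linear subspace_UNIV subset_UNIV)
  moreover have "finite B"
    using B(1) by (rule pairwise_orthogonal_imp_finite)
  ultimately show ?thesis using that by metis
qed

lemma matrix_eq_on_span:
  fixes A A' :: "real ^ 'd ^ 'd"
  assumes "\<And>b. b \<in> B \<Longrightarrow> A *v b = A' *v b" and "span B = UNIV"
  shows "A = A'"
proof -
  have "A *v x = A' *v x" for x
    using linear_eq_on_span[of "(*v) A" "(*v) A'" B x] assms by simp
  then show ?thesis by (simp add: matrix_eq)
qed

text \<open>The sum of the outer products of \<open>b\<close> with itself, scaled by
  \<open>l b\<close>. For orthonormal \<open>B\<close> it has the eigenvectors \<open>b\<close> with
  eigenvalues \<open>l b\<close>, so it serves to apply a function to the eigenvalues of a
  matrix.\<close>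

definition spectral_matrix :: "(real ^ 'd) set \<Rightarrow> (real ^ 'd \<Rightarrow> real) \<Rightarrow> real ^ 'd ^ 'd" where
  "spectral_matrix B l = (\<chi> i j. \<Sum>b\<in>B. l b * b $ i * b $ j)"

lemma transpose_spectral_matrix [simp]: "transpose (spectral_matrix B l) = spectral_matrix B l"
  by (simp add: spectral_matrix_def transpose_def mult_ac)

lemma spectral_matrix_mult_vec: "spectral_matrix B l *v x = (\<Sum>b\<in>B. (l b * (b \<bullet> x)) *\<^sub>R b)"
proof -
  have "(\<Sum>j\<in>UNIV. (\<Sum>b\<in>B. l b * b $ i * b $ j) * x $ j) = (\<Sum>b\<in>B. (l b * (b \<bullet> x)) * b $ i)" for i
    unfolding sum_distrib_right inner_vec_def sum_distrib_left
    by (subst sum.swap) (simp add: mult_ac)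
  then show ?thesis
    by (simp add: vec_eq_iff matrix_vector_mult_def spectral_matrix_def)
qed

lemma spectral_matrix_eigenvector:
  assumes "finite B" "pairwise orthogonal B" "\<And>b. b \<in> B \<Longrightarrow> norm b = 1" "b \<in> B"
  shows "spectral_matrix B l *v b = l b *\<^sub>R b"
proof -
  have "(l c * (c \<bullet> b)) *\<^sub>R c = (if c = b then l b *\<^sub>R b else 0)" if "c \<in> B" for c
    using assms that by (auto simp: pairwise_def orthogonal_def norm_eq_1)
  then show ?thesis
    using assms by (simp add: spectral_matrix_mult_vec)
qed

text \<open>Diagonalizing \<open>S - R\<close> avoids a common eigenbasis of \<open>S\<close> and
  \<open>R\<close>. For an eigenvector \<open>b\<close> with eigenvalue \<open>l b\<close>, the
  equality of the norms of \<open>S *v b\<close> and \<open>R *v b\<close> gives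
  \<open>l b * (b \<bullet> (S *v b) + b \<bullet> (R *v b)) = 0\<close>. Both summands are
  nonnegative and differ by \<open>l b\<close>, so \<open>l b = 0\<close>.\<close>

lemma pos_semidef_sqrt_unique:
  fixes S R :: "real ^ 'd ^ 'd"
  assumes S: "pos_semidef S" and R: "pos_semidef R" and eq: "S ** S = R ** R"
  shows "S = R"
proof -
  have sym: "transpose S = S" "transpose R = R" using S R by (auto simp: pos_semidef_def)
  have "transpose (S - R) = S - R" using sym by (simp add: transpose_def vec_eq_iff)
  then obtain B l where B: "span B = UNIV" "\<And>b. b \<in> B \<Longrightarrow> norm b = 1"
      "\<And>b. b \<in> B \<Longrightarrow> (S - R) *v b = l b *\<^sub>R b"
    using symmetric_matrix_eigenbasis by metis
  show ?thesis
  proof (rule matrix_eq_on_span[OF _ B(1)])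
    fix b assume b: "b \<in> B"
    have ev: "S *v b = R *v b + l b *\<^sub>R b"
      using B(3)[OF b] by (simp add: matrix_vector_mult_diff_rdistrib algebra_simps)
    have bb: "b \<bullet> b = 1" using B(2)[OF b] by (simp add: norm_eq_1)
    have "(S *v b) \<bullet> (S *v b) = (R *v b) \<bullet> (R *v b)"
      using eq by (metis inner_matrix_vector_symmetric matrix_vector_mul_assoc sym)
    then have "l b * (b \<bullet> (S *v b) + b \<bullet> (R *v b)) = 0"
      by (simp add: ev inner_add_left inner_add_right inner_commute[of "R *v b" b] algebra_simps)
    moreover have "0 \<le> b \<bullet> (S *v b)" "0 \<le> b \<bullet> (R *v b)"
      using S R by (auto simp: pos_semidef_def)
    moreover have "b \<bullet> (S *v b) = b \<bullet> (R *v b) + l b" by (simp add: ev inner_add_right bb)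
    ultimately have "l b = 0" by (smt (verit) mult_eq_0_iff)
    then show "S *v b = R *v b" using ev by simp
  qed
qed

text \<open>Existence comes from taking square roots of the eigenvalues in an orthonormal
  eigenbasis; with uniqueness, the definite description denotes this matrix.\<close>

lemma psd_sqrt:
  fixes V :: "real ^ 'd ^ 'd"
  assumes V: "pos_semidef V"
  shows "pos_semidef (psd_sqrt V) \<and> psd_sqrt V ** psd_sqrt V = V"
proof -
  obtain B l where B: "finite B" "pairwise orthogonal B" "\<And>b. b \<in> B \<Longrightarrow> norm b = 1" "span B = UNIV"
      and l: "\<And>b. b \<in> B \<Longrightarrow> V *v b = l b *\<^sub>R b"
    using symmetric_matrix_eigenbasis V unfolding pos_semidef_def by metis
  have l_nonneg: "0 \<le> l b" if "b \<in> B" for b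
  proof -
    have "0 \<le> b \<bullet> (V *v b)" using V by (auto simp: pos_semidef_def)
    then show ?thesis using l[OF that] B(3)[OF that] by (simp add: norm_eq_1)
  qed
  define S where "S = spectral_matrix B (\<lambda>b. sqrt (l b))"
  have S: "S *v b = sqrt (l b) *\<^sub>R b" if "b \<in> B" for b
    unfolding S_def using spectral_matrix_eigenvector[OF B(1-3) that] .
  have "S ** S = V"
    by (rule matrix_eq_on_span[OF _ B(4)])
      (simp add: S l l_nonneg matrix_vector_mul_assoc[symmetric] matrix_vector_mult_scaleR)
  moreover have "0 \<le> x \<bullet> (S *v x)" for x
    using l_nonneg
    by (simp add: S_def spectral_matrix_mult_vec inner_sum_right inner_commute[of x] sum_nonneg mult.assoc)
  ultimately have S: "pos_semidef S \<and> S ** S = V" by (simp add: pos_semidef_def S_def)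
  show ?thesis
    unfolding psd_sqrt_def
  proof (rule theI)
    show "pos_semidef S \<and> S ** S = V" by (fact S)
    show "R = S" if "pos_semidef R \<and> R ** R = V" for R
      using that S by (simp add: pos_semidef_sqrt_unique)
  qed
qed

text \<open>Inverting the nonzero eigenvalues solves the four Penrose equations, and these have only
  one solution. The equation concluded here evaluates the norm of affine functions on the range of
  \<open>V\<close>.\<close>

lemma pseudo_inv:
  fixes V :: "real ^ 'd ^ 'd"
  assumes "transpose V = V"
  shows "V ** pseudo_inv V ** V = V"
proof -
  define penrose where "penrose P \<longleftrightarrow> V ** P ** V = V \<and> P ** V ** P = P
     \<and> transpose (V ** P) = V ** P \<and> transpose (P ** V) = P ** V" for P
  obtain B l where B: "finite B" "pairwise orthogonal B" "\<And>b. b \<in> B \<Longrightarrow> norm b = 1" "span B = UNIV"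
      and l: "\<And>b. b \<in> B \<Longrightarrow> V *v b = l b *\<^sub>R b"
    using symmetric_matrix_eigenbasis assms by metis
  \<comment> \<open>Since \<open>inverse 0 = 0\<close>, zero eigenvalues stay zero and
    \<open>l b * inverse (l b)\<close> is 0 or 1. Thus \<open>E\<close> below is the orthogonal
    projection onto the range of \<open>V\<close>.\<close>
  define P where "P = spectral_matrix B (\<lambda>b. inverse (l b))"
  define E where "E = spectral_matrix B (\<lambda>b. l b * inverse (l b))"
  have P: "P *v b = inverse (l b) *\<^sub>R b" if "b \<in> B" for b
    unfolding P_def using spectral_matrix_eigenvector[OF B(1-3) that] .
  have E: "E *v b = (l b * inverse (l b)) *\<^sub>R b" if "b \<in> B" for b
    unfolding E_def using spectral_matrix_eigenvector[OF B(1-3) that] .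
  note simps = l P E matrix_vector_mul_assoc[symmetric] matrix_vector_mult_scaleR
  have "V ** P ** V = V" "P ** V ** P = P" "V ** P = E" "P ** V = E"
    by (rule matrix_eq_on_span[OF _ B(4)], auto simp: simps)+
  then have "penrose P" by (simp add: penrose_def E_def)
  moreover have "Q = P" if Q: "penrose Q" for Q
  proof -
    \<comment> \<open>\<open>V ** P\<close> and \<open>V ** Q\<close> are symmetric, so transposing
      their product swaps the factors; either order collapses by \<open>V ** Q ** V = V\<close> or
      \<open>V ** P ** V = V\<close>.\<close>
    have "V ** P = transpose (V ** Q ** (V ** P))"
      using Q \<open>penrose P\<close> by (metis matrix_mul_assoc penrose_def)
    also have "\<dots> = V ** P ** (V ** Q)"
      using Q \<open>penrose P\<close> by (metis matrix_transpose_mul penrose_def)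
    also have "\<dots> = V ** Q" using \<open>penrose P\<close> by (metis matrix_mul_assoc penrose_def)
    finally have VP: "V ** P = V ** Q" .
    have "P ** V = transpose (P ** V ** (Q ** V))"
      using Q \<open>penrose P\<close> by (metis matrix_mul_assoc penrose_def)
    also have "\<dots> = Q ** V ** (P ** V)"
      using Q \<open>penrose P\<close> by (metis matrix_transpose_mul penrose_def)
    also have "\<dots> = Q ** V" using \<open>penrose P\<close> by (metis matrix_mul_assoc penrose_def)
    finally have PV: "P ** V = Q ** V" .
    have "Q = Q ** (V ** Q)" using Q by (simp add: penrose_def matrix_mul_assoc)
    also have "\<dots> = (Q ** V) ** P" unfolding VP[symmetric] by (rule matrix_mul_assoc)
    also have "\<dots> = P" unfolding PV[symmetric] using \<open>penrose P\<close> by (simp add: penrose_def)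
    finally show "Q = P" .
  qed
  ultimately have "penrose (THE P. penrose P)" by (intro theI[of penrose P])
  then show ?thesis by (simp add: penrose_def pseudo_inv_def)
qed


section \<open>The quotient of the affine functions by the constants\<close>

text \<open>Metric axioms, completeness and continuity are transported along a distance-preserving
  map of \<open>G\<close> onto \<open>M\<close>. The value 0 outside \<open>M\<close> settles the
  axioms that \<open>Metric_space\<close> imposes on all arguments.\<close>

lemma isometric_image:
  fixes f :: "'a::metric_space \<Rightarrow> 'b" and G :: "'a set"
  assumes M: "M = f ` G"
    and d: "\<And>x y. x \<in> G \<Longrightarrow> y \<in> G \<Longrightarrow> d (f x) (f y) = dist x y"
    and outside: "\<And>A B. A \<notin> M \<or> B \<notin> M \<Longrightarrow> d A B = 0"
  shows Metric_space_isometric_image: "Metric_space M d"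
    and mcomplete_isometric_image: "complete G \<Longrightarrow> Metric_space.mcomplete M d"
    and continuous_map_isometric_image: "continuous_on G (\<lambda>x. h (f x)) \<Longrightarrow>
      continuous_map (Metric_space.mtopology M d) euclideanreal h"
proof -
  show "Metric_space M d"
  proof
    fix A B
    show "0 \<le> d A B"
      by (cases "A \<in> M \<and> B \<in> M") (auto simp: M d outside)
    show "d A B = d B A"
      by (cases "A \<in> M \<and> B \<in> M") (auto simp: M d outside dist_commute)
  qed (auto simp: M d dist_triangle)
  then interpret Metric_space M d .
  show mcomplete if complete: "complete G"
    unfolding mcomplete_def
  proof (intro allI impI)
    fix \<sigma> assume "MCauchy \<sigma>"
    then have "range \<sigma> \<subseteq> M" by (simp add: MCauchy_def)
    then have \<sigma>: "\<sigma> n \<in> f ` G" for n using M by blast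
    \<comment> \<open>The limit is found in \<open>G\<close>: the chosen preimages form a Cauchy
      sequence there because \<open>f\<close> preserves distances.\<close>
    define g where "g n = inv_into G f (\<sigma> n)" for n
    have g: "g n \<in> G" "f (g n) = \<sigma> n" for n
      using \<sigma> by (auto simp: g_def inv_into_into f_inv_into_f)
    have "Cauchy g"
      using \<open>MCauchy \<sigma>\<close> g d unfolding MCauchy_def Cauchy_def by metis
    then obtain l where l: "l \<in> G" "g \<longlonglongrightarrow> l"
      using completeE[OF complete] g(1) by metis
    have "limitin mtopology \<sigma> (f l) sequentially"
      unfolding limit_metric_sequentially
    proof (intro conjI allI impI)
      show "f l \<in> M" using l by (simp add: M)
      fix e :: real assume "0 < e"
      then obtain N where "\<forall>n\<ge>N. dist (g n) l < e" using l(2) by (meson metric_LIMSEQ_D)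
      then show "\<exists>N. \<forall>n\<ge>N. \<sigma> n \<in> M \<and> d (\<sigma> n) (f l) < e"
        using \<sigma> g d[OF _ l(1)] by (metis M)
    qed
    then show "\<exists>x. limitin mtopology \<sigma> x sequentially" by blast
  qed
  show "continuous_map mtopology euclideanreal h" if cont: "continuous_on G (\<lambda>x. h (f x))"
    \<comment> \<open>With \<open>euclideanreal\<close> seen as the topology of the standard metric,
      continuity becomes the epsilon-delta criterion between two metric spaces.\<close>
    unfolding mtopology_is_euclidean[symmetric] metric_continuous_map[OF Met_TC.Metric_space_axioms]
  proof (intro conjI ballI allI impI)
    fix a e assume "a \<in> M" "0 < (e::real)"
    then obtain x where x: "x \<in> G" "a = f x" by (auto simp: M)
    then obtain \<delta> where "\<delta> > 0" "\<forall>y\<in>G. dist y x < \<delta> \<longrightarrow> dist (h (f y)) (h (f x)) < e"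
      using cont \<open>0 < e\<close> unfolding continuous_on_iff by blast
    then show "\<exists>\<delta>>0. \<forall>b. b \<in> M \<and> d a b < \<delta> \<longrightarrow> dist (h a) (h b) < e"
      using x d by (intro exI[of _ \<delta>]) (auto simp: M dist_commute)
  qed simp
qed

section \<open>Affine functions in the coordinates given by the square root of
  \<open>V\<close>\<close>

locale psd_affine =
  fixes V :: "real ^ 'd ^ 'd" and D :: "(real ^ 'd) set"
  assumes psd: "pos_semidef V" and nonempty: "D \<noteq> {}"
begin

abbreviation S :: "real ^ 'd ^ 'd" where "S \<equiv> psd_sqrt V"

definition aff :: "real \<times> (real ^ 'd) \<Rightarrow> real ^ 'd \<Rightarrow> real" where
  "aff p = (\<lambda>x\<in>D. fst p + snd p \<bullet> (S *v x))"

text \<open>A slope \<open>c = S *v u\<close> stands for the coefficient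
  \<open>S *v c = V *v u\<close> of \<open>x\<close>. Slopes in the range of \<open>S\<close> thus
  give exactly the coefficients in the range of \<open>V\<close>.\<close>

definition coeffs :: "(real \<times> (real ^ 'd)) set" where
  "coeffs = UNIV \<times> range ((*v) S)"

lemma inner_S: "x \<bullet> (S *v y) = (S *v x) \<bullet> y"
  using psd_sqrt[OF psd] by (intro inner_matrix_vector_symmetric) (simp add: pos_semidef_def)

lemma S_S: "S *v (S *v x) = V *v x"
  using psd_sqrt[OF psd] by (simp add: matrix_vector_mul_assoc)

lemma subspace_range_S: "subspace (range ((*v) S))"
  by (intro linear_subspace_image matrix_vector_mul_linear subspace_UNIV)

lemma subspace_coeffs: "subspace coeffs"
  unfolding coeffs_def using subspace_range_S by (intro subspace_Times subspace_UNIV)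

lemma aff_add: "(\<lambda>x\<in>D. aff p x + aff q x) = aff (p + q)"
  by (auto simp: aff_def fun_eq_iff inner_add_left)

lemma aff_diff: "(\<lambda>x\<in>D. aff p x - aff q x) = aff (p - q)"
  by (auto simp: aff_def fun_eq_iff inner_diff_left)

lemma aff_scale: "(\<lambda>x\<in>D. a * aff p x) = aff (a *\<^sub>R p)"
  by (auto simp: aff_def fun_eq_iff distrib_left)

lemma affine_functions_eq: "affine_functions V D = aff ` coeffs"
proof -
  have "(\<lambda>x\<in>D. b0 + (V *v u) \<bullet> x) = aff (b0, S *v u)" for b0 u
    by (simp add: aff_def inner_S S_S)
  moreover have "affine_functions V D = (\<Union>b0 u. {\<lambda>x\<in>D. b0 + (V *v u) \<bullet> x})"
    by (auto simp: affine_functions_def)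
  moreover have "aff ` coeffs = (\<Union>b0 u. {aff (b0, S *v u)})"
    by (auto simp: coeffs_def)
  ultimately show ?thesis by simp
qed

text \<open>For \<open>b = V *v u\<close>, the identity \<open>V ** pseudo_inv V ** V = V\<close>
  turns the quadratic form at \<open>b\<close> into \<open>u \<bullet> (V *v u)\<close>, the squared
  norm of \<open>S *v u\<close>. So the weighted norm is the Euclidean norm of the pair.\<close>

lemma affine_norm_eq: "affine_norm V D f = (INF p\<in>{p \<in> coeffs. f = aff p}. ereal (norm p))"
proof -
  have aff: "(\<lambda>x\<in>D. b0 + (V *v u) \<bullet> x) = aff (b0, S *v u)" for b0 u
    by (simp add: aff_def inner_S S_S)
  have "V *v (pseudo_inv V *v (V *v u)) = V *v u" for u
    using pseudo_inv[of V] psd by (simp add: matrix_vector_mul_assoc pos_semidef_def matrix_mul_assoc)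
  then have "(V *v u) \<bullet> (pseudo_inv V *v (V *v u)) = (S *v u) \<bullet> (S *v u)" for u
    using psd by (metis S_S inner_S inner_matrix_vector_symmetric pos_semidef_def)
  then have norm: "sqrt ((V *v u) \<bullet> (pseudo_inv V *v (V *v u)) + b0\<^sup>2) = norm (b0, S *v u)" for b0 u
    by (simp add: norm_Pair power2_norm_eq_inner add.commute)
  \<comment> \<open>The two infima range over different parameters, so the sets of values are
    compared instead of the index sets.\<close>
  have "(\<lambda>(b0, b). ereal (sqrt (b \<bullet> (pseudo_inv V *v b) + b0\<^sup>2))) `
      {(b0, b). b \<in> range ((*v) V) \<and> f = (\<lambda>x\<in>D. b0 + b \<bullet> x)}
    = {ereal (norm (b0, S *v u)) | b0 u. f = aff (b0, S *v u)}"
    unfolding norm[symmetric] aff[symmetric] by (auto simp: image_iff)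
  also have "\<dots> = (\<lambda>p. ereal (norm p)) ` {p \<in> coeffs. f = aff p}"
    by (auto simp: coeffs_def image_iff)
  finally show ?thesis unfolding affine_norm_def by simp
qed

lemma affine_norm_le: "p \<in> coeffs \<Longrightarrow> affine_norm V D (aff p) \<le> ereal (norm p)"
  unfolding affine_norm_eq by (rule INF_lower) simp

lemma affine_norm_ge:
  "(\<And>p. p \<in> coeffs \<Longrightarrow> f = aff p \<Longrightarrow> r \<le> norm p) \<Longrightarrow> ereal r \<le> affine_norm V D f"
  unfolding affine_norm_eq by (rule INF_greatest) simp

lemma affine_norm_lessE:
  assumes "affine_norm V D f < ereal r"
  obtains p where "p \<in> coeffs" "f = aff p" "norm p < r"
  using assms unfolding affine_norm_eq INF_less_iff by auto

lemma affine_norm_real: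
  assumes "f \<in> affine_functions V D"
  obtains r where "affine_norm V D f = ereal r" "0 \<le> r"
proof -
  have "ereal 0 \<le> affine_norm V D f" by (rule affine_norm_ge) simp
  moreover obtain p where "p \<in> coeffs" "f = aff p"
    using assms unfolding affine_functions_eq by blast
  then have "affine_norm V D f \<le> ereal (norm p)" by (simp add: affine_norm_le)
  ultimately show ?thesis using that by (cases "affine_norm V D f") auto
qed

section \<open>Vector space and seminorm axioms for the affine functions\<close>

lemma function_space_affine: "function_space D (affine_functions V D)"
  unfolding function_space_def affine_functions_eq
proof (intro conjI allI ballI)
  show "aff ` coeffs \<subseteq> extensional D" by (auto simp: aff_def)
  have "0 \<in> range ((*v) S)" using subspace_range_S subspace_0 by blast
  then have "(c, 0) \<in> coeffs" for c by (simp add: coeffs_def)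
  then have "aff (c, 0) \<in> aff ` coeffs" for c by blast
  then show "(\<lambda>x\<in>D. c) \<in> aff ` coeffs" for c by (simp add: aff_def)
  show "(\<lambda>x\<in>D. f x + g x) \<in> aff ` coeffs" if "f \<in> aff ` coeffs" "g \<in> aff ` coeffs" for f g
    using that subspace_coeffs by (auto simp: aff_add subspace_add simp del: add_Pair)
  show "(\<lambda>x\<in>D. a * f x) \<in> aff ` coeffs" if "f \<in> aff ` coeffs" for a f
    using that subspace_coeffs by (auto simp: aff_scale subspace_scale simp del: scaleR_Pair)
qed

text \<open>Attainment of the infimum is avoided: representations that are optimal up to a slack
  reduce the inequalities to those of the Euclidean norm on \<open>coeffs\<close>.\<close>

lemma seminorm_affine: "seminorm_on D (affine_functions V D) (affine_norm V D)"
  unfolding seminorm_on_def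
proof (intro conjI allI ballI)
  let ?F = "affine_functions V D" and ?N = "affine_norm V D"
  fix f assume f: "f \<in> ?F"
  then obtain r where r: "?N f = ereal r" "0 \<le> r" by (rule affine_norm_real)
  then show "0 \<le> ?N f" "?N f < \<infinity>" by auto
  show "?N (\<lambda>x\<in>D. f x + g x) \<le> ?N f + ?N g" if "g \<in> ?F" for g
  proof (rule ereal_le_epsilon2)
    fix e :: real assume "0 < e"
    obtain s where s: "?N g = ereal s" using affine_norm_real[OF \<open>g \<in> ?F\<close>] by blast
    obtain p where p: "p \<in> coeffs" "f = aff p" "norm p < r + e / 2"
      using affine_norm_lessE[of f "r + e / 2"] \<open>0 < e\<close> r by auto
    obtain q where q: "q \<in> coeffs" "g = aff q" "norm q < s + e / 2"
      using affine_norm_lessE[of g "s + e / 2"] \<open>0 < e\<close> s by auto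
    have "?N (\<lambda>x\<in>D. f x + g x) \<le> ereal (norm (p + q))"
      using p q subspace_coeffs by (auto simp: aff_add subspace_add intro!: affine_norm_le)
    also have "\<dots> \<le> ereal (r + s + e)"
      using norm_triangle_ineq[of p q] p q by simp
    finally show "?N (\<lambda>x\<in>D. f x + g x) \<le> ?N f + ?N g + ereal e" by (simp add: r s)
  qed
  \<comment> \<open>This bound yields homogeneity: for \<open>a \<noteq> 0\<close>, applying it to
    the factor \<open>inverse a\<close> and the function \<open>a * f\<close> gives the reverse
    inequality.\<close>
  have scale_le: "?N (\<lambda>x\<in>D. a * h x) \<le> ereal \<bar>a\<bar> * ?N h" if h: "h \<in> ?F" for a h
  proof (cases "a = 0")
    case True
    have "0 \<in> coeffs" using subspace_coeffs by (rule subspace_0)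
    moreover have "(\<lambda>x\<in>D. a * h x) = aff 0" by (simp add: True aff_def fun_eq_iff)
    ultimately show ?thesis using affine_norm_le[of 0]
      by (simp add: True flip: zero_ereal_def)
  next
    case False
    obtain s where s: "?N h = ereal s" using affine_norm_real[OF h] by blast
    show ?thesis
    proof (rule ereal_le_epsilon2)
      fix e :: real assume "0 < e"
      then obtain p where p: "p \<in> coeffs" "h = aff p" "norm p < s + e / \<bar>a\<bar>"
        using affine_norm_lessE[of h "s + e / \<bar>a\<bar>"] False s by auto
      have "?N (\<lambda>x\<in>D. a * h x) \<le> ereal (norm (a *\<^sub>R p))"
        using p(1) subspace_coeffs unfolding p(2) aff_scale by (intro affine_norm_le subspace_scale)
      also have "\<dots> \<le> ereal (\<bar>a\<bar> * s + e)"
        using p(3) False by (simp add: field_simps)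
      finally show "?N (\<lambda>x\<in>D. a * h x) \<le> ereal \<bar>a\<bar> * ?N h + ereal e" by (simp add: s)
    qed
  qed
  show "?N (\<lambda>x\<in>D. a * f x) = ereal \<bar>a\<bar> * ?N f" for a
  proof (rule antisym[OF scale_le[OF f]])
    let ?g = "\<lambda>x\<in>D. a * f x"
    have g: "?g \<in> ?F" using function_space_affine f by (simp add: function_space_def)
    then obtain s where s: "?N ?g = ereal s" "0 \<le> s" by (rule affine_norm_real)
    show "ereal \<bar>a\<bar> * ?N f \<le> ?N ?g"
    proof (cases "a = 0")
      case False
      have "f \<in> extensional D" using function_space_affine f by (auto simp: function_space_def)
      then have "(\<lambda>x\<in>D. inverse a * ?g x) = f"
        using False by (auto simp: fun_eq_iff extensional_def)
      with scale_le[OF g, of "inverse a"] False show ?thesis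
        by (simp add: r s field_simps)
    qed (use s in \<open>simp add: zero_ereal_def[symmetric]\<close>)
  qed
qed

text \<open>Two slopes give the same function on \<open>D\<close> up to a constant iff their difference is
  orthogonal to \<open>diffs\<close>. So every class has exactly one slope in \<open>diffs\<close>, and that slope has
  the smallest norm of all slopes in the class.\<close>

definition diffs :: "(real ^ 'd) set" where
  "diffs = span {S *v x - S *v y | x y. x \<in> D \<and> y \<in> D}"

definition slope_class :: "real ^ 'd \<Rightarrow> (real ^ 'd \<Rightarrow> real) set" where
  "slope_class c = range (\<lambda>k. aff (k, c))"

lemma subspace_diffs: "subspace diffs"
  unfolding diffs_def by (rule subspace_span)

lemma diffs_subset_range: "diffs \<subseteq> range ((*v) S)"
  unfolding diffs_def using subspace_range_S
  by (intro span_minimal) (auto simp: matrix_vector_mult_diff_distrib[symmetric])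

lemma slope_coeffs: "g \<in> diffs \<Longrightarrow> (k, g) \<in> coeffs"
  using diffs_subset_range by (auto simp: coeffs_def)

text \<open>On \<open>D\<close> the value \<open>(c - c') \<bullet> (S *v x)\<close> is the constant
  \<open>k' - k\<close>, so \<open>c - c'\<close> annihilates all differences and hence their
  span.\<close>

lemma orthogonal_diffs_if_aff_eq:
  assumes eq: "aff (k, c) = aff (k', c')" and "w \<in> diffs"
  shows "(c - c') \<bullet> w = 0"
proof -
  have "k + c \<bullet> (S *v x) = k' + c' \<bullet> (S *v x)" if "x \<in> D" for x
    using fun_cong[OF eq, of x] that by (simp add: aff_def)
  then have "(c - c') \<bullet> (S *v x) = k' - k" if "x \<in> D" for x
    using that by (simp add: inner_diff_left algebra_simps)
  then have "(c - c') \<bullet> (S *v x - S *v y) = 0" if "x \<in> D" "y \<in> D" for x y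
    using that by (simp add: inner_diff_right)
  then have "orthogonal (c - c') w"
    by (intro orthogonal_to_span[OF \<open>w \<in> diffs\<close>[unfolded diffs_def]]) (auto simp: orthogonal_def)
  then show ?thesis by (simp add: orthogonal_def)
qed

text \<open>A slope difference orthogonal to \<open>diffs\<close> contributes the same value at
  every point of \<open>D\<close>. Evaluated at a base point \<open>y\<close>, that value is
  absorbed into the intercept.\<close>

lemma slope_class_cong:
  assumes "\<And>w. w \<in> diffs \<Longrightarrow> (c - c') \<bullet> w = 0"
  shows "slope_class c = slope_class c'"
proof -
  have subset: "slope_class a \<subseteq> slope_class b" if orth: "\<And>w. w \<in> diffs \<Longrightarrow> (a - b) \<bullet> w = 0" for a b
  proof
    fix f assume "f \<in> slope_class a"
    then obtain k where f: "f = aff (k, a)" by (auto simp: slope_class_def)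
    obtain y where y: "y \<in> D" using nonempty by blast
    have "k + a \<bullet> (S *v x) = k + (a - b) \<bullet> (S *v y) + b \<bullet> (S *v x)" if "x \<in> D" for x
    proof -
      have "S *v x - S *v y \<in> diffs" unfolding diffs_def using that y by (intro span_base) blast
      from orth[OF this] show ?thesis by (simp add: inner_diff_left inner_diff_right)
    qed
    then have "f = aff (k + (a - b) \<bullet> (S *v y), b)" by (simp add: f aff_def fun_eq_iff)
    then show "f \<in> slope_class b" by (simp add: slope_class_def)
  qed
  have "(c' - c) \<bullet> w = 0" if "w \<in> diffs" for w
    using assms[OF that] by (simp add: inner_diff_left)
  with assms show ?thesis using subset by (metis antisym)
qed

section \<open>The quotient by the constants as an isometric copy of \<open>diffs\<close>\<close>

lemma const_class_aff: "const_class D (aff (k, c)) = slope_class c"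
proof -
  have "(\<lambda>x\<in>D. aff (k, c) x + a) = aff (k + a, c)" for a
    by (auto simp: aff_def fun_eq_iff)
  moreover have "range (\<lambda>a. aff (k + a, c)) = range (\<lambda>a. aff (a, c))"
    using image_image[of "\<lambda>a. aff (a, c)" "(+) k" UNIV] by simp
  ultimately show ?thesis by (simp add: const_class_def slope_class_def)
qed

text \<open>Projecting a slope orthogonally onto \<open>diffs\<close> leaves its class unchanged,
  because the residual is orthogonal to \<open>diffs\<close>.\<close>

lemma mod_const_affine: "mod_const D (affine_functions V D) = slope_class ` diffs"
proof
  show "mod_const D (affine_functions V D) \<subseteq> slope_class ` diffs"
  proof
    fix A assume "A \<in> mod_const D (affine_functions V D)"
    then obtain c where A: "A = slope_class c"
      by (auto simp: mod_const_def affine_functions_eq const_class_aff)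
    obtain g z where "g \<in> span diffs" "\<And>w. w \<in> span diffs \<Longrightarrow> orthogonal z w" "c = g + z"
      using orthogonal_subspace_decomp_exists by blast
    then have "g \<in> diffs" "\<And>w. w \<in> diffs \<Longrightarrow> (c - g) \<bullet> w = 0"
      using subspace_diffs by (auto simp: span_eq_iff[THEN iffD2] orthogonal_def)
    then show "A \<in> slope_class ` diffs" using slope_class_cong A by blast
  qed
  show "slope_class ` diffs \<subseteq> mod_const D (affine_functions V D)"
  proof
    fix A assume "A \<in> slope_class ` diffs"
    then obtain g where "g \<in> diffs" "A = const_class D (aff (0, g))"
      by (auto simp: const_class_aff)
    then show "A \<in> mod_const D (affine_functions V D)"
      using slope_coeffs by (auto simp: mod_const_def affine_functions_eq)
  qed
qed

text \<open>The representative with intercept 0 gives the upper bound. Any other representation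
  \<open>p\<close> has \<open>snd p - g\<close> orthogonal to \<open>g\<close>, so
  \<open>g \<bullet> g = snd p \<bullet> g\<close>, and Cauchy-Schwarz gives the lower
  bound.\<close>

lemma class_norm_slope_class:
  assumes g: "g \<in> diffs"
  shows "class_norm (affine_norm V D) (slope_class g) = ereal (norm g)"
proof (rule antisym)
  have "aff (0, g) \<in> slope_class g" by (simp add: slope_class_def)
  then have "class_norm (affine_norm V D) (slope_class g) \<le> affine_norm V D (aff (0, g))"
    unfolding class_norm_def by (rule INF_lower)
  also have "\<dots> \<le> ereal (norm g)"
    using affine_norm_le[OF slope_coeffs[OF g, of 0]] by (simp add: norm_Pair)
  finally show "class_norm (affine_norm V D) (slope_class g) \<le> ereal (norm g)" .
  show "ereal (norm g) \<le> class_norm (affine_norm V D) (slope_class g)"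
    unfolding class_norm_def
  proof (intro INF_greatest affine_norm_ge)
    fix f p assume "f \<in> slope_class g" "f = aff p"
    then obtain k where "aff (fst p, snd p) = aff (k, g)" by (auto simp: slope_class_def)
    then have "(snd p - g) \<bullet> g = 0" using g by (rule orthogonal_diffs_if_aff_eq)
    then have "(norm g)\<^sup>2 = snd p \<bullet> g" by (simp add: inner_diff_left power2_norm_eq_inner)
    also have "\<dots> \<le> norm (snd p) * norm g" by (rule norm_cauchy_schwarz)
    finally have "norm g \<le> norm (snd p)" by (cases "g = 0") (simp_all add: power2_eq_square)
    also have "\<dots> \<le> norm p" using norm_snd_le[of "snd p" "fst p"] by simp
    finally show "norm g \<le> norm p" .
  qed
qed

text \<open>Subtracting classes subtracts their slopes, and \<open>g - h\<close> lies in
  \<open>diffs\<close> again, where the class norm is the Euclidean norm.\<close>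

lemma class_dist_slope_class:
  assumes "g \<in> diffs" "h \<in> diffs"
  shows "class_dist D (affine_functions V D) (affine_norm V D) (slope_class g) (slope_class h) = dist g h"
proof -
  have "class_diff D (slope_class g) (slope_class h) = slope_class (g - h)"
  proof
    show "class_diff D (slope_class g) (slope_class h) \<subseteq> slope_class (g - h)"
      by (auto simp: class_diff_def slope_class_def aff_diff)
    have "aff (k, g - h) = (\<lambda>x\<in>D. aff (k, g) x - aff (0, h) x)" for k
      by (simp add: aff_diff)
    then have "aff (k, g - h) \<in> class_diff D (slope_class g) (slope_class h)" for k
      unfolding class_diff_def slope_class_def by blast
    then show "slope_class (g - h) \<subseteq> class_diff D (slope_class g) (slope_class h)"
      by (auto simp: slope_class_def)
  qed
  moreover have "g - h \<in> diffs" using assms subspace_diffs by (simp add: subspace_diff)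
  ultimately show ?thesis
    using assms by (simp add: class_dist_def mod_const_affine class_norm_slope_class dist_norm)
qed

text \<open>As a subspace of a finite-dimensional space, \<open>diffs\<close> is closed and hence
  complete; everything transfers along \<open>slope_class\<close>. A map on the quotient is then
  shown continuous as a function of the slope.\<close>

lemma slope_class_isometry:
  shows "Metric_space (mod_const D (affine_functions V D))
      (class_dist D (affine_functions V D) (affine_norm V D))"
    and "Metric_space.mcomplete (mod_const D (affine_functions V D))
      (class_dist D (affine_functions V D) (affine_norm V D))"
    and "continuous_on diffs (\<lambda>g. h (slope_class g)) \<Longrightarrow>
      continuous_map (Metric_space.mtopology (mod_const D (affine_functions V D))
        (class_dist D (affine_functions V D) (affine_norm V D))) euclideanreal h"
proof -
  have outside: "class_dist D (affine_functions V D) (affine_norm V D) A B = 0"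
    if "A \<notin> mod_const D (affine_functions V D) \<or> B \<notin> mod_const D (affine_functions V D)" for A B
    using that by (auto simp: class_dist_def)
  show "Metric_space (mod_const D (affine_functions V D))
      (class_dist D (affine_functions V D) (affine_norm V D))"
    by (rule isometric_image(1)[OF mod_const_affine]) (simp_all add: class_dist_slope_class outside)
  have "complete diffs"
    using closed_subspace[OF subspace_diffs] by (simp add: complete_eq_closed)
  then show "Metric_space.mcomplete (mod_const D (affine_functions V D))
      (class_dist D (affine_functions V D) (affine_norm V D))"
    by (rule isometric_image(2)[OF mod_const_affine, rotated 2])
      (simp_all add: class_dist_slope_class outside)
  show "continuous_map (Metric_space.mtopology (mod_const D (affine_functions V D))
        (class_dist D (affine_functions V D) (affine_norm V D))) euclideanreal h"
    if "continuous_on diffs (\<lambda>g. h (slope_class g))"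
    using that by (rule isometric_image(3)[OF mod_const_affine, rotated 2])
      (simp_all add: class_dist_slope_class outside)
qed

end


section \<open>The dual norm of the error\<close>

definition mean_difference ::
    "('n::finite \<Rightarrow> nat) \<Rightarrow> ('n \<Rightarrow> real ^ 'd) \<Rightarrow> ('n \<Rightarrow> real) \<Rightarrow> real ^ 'd" where
  "mean_difference T X W =
     (1 / real (card (treatment_group T 1))) *\<^sub>R (\<Sum>i\<in>treatment_group T 1. X i)
       - (\<Sum>i\<in>treatment_group T 0. W i *\<^sub>R X i)"

context psd_affine
begin

text \<open>Treated and control weights both have total 1, so the intercept cancels; the rest is
  linear in the points.\<close>

lemma matching_error_aff:
  assumes "treatment_group T 1 \<noteq> {}" and "\<forall>i. X i \<in> D"
    and "(\<Sum>i\<in>treatment_group T 0. W i) = 1"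
  shows "matching_error T X W (aff (k, c)) = c \<bullet> (S *v mean_difference T X W)"
proof -
  let ?T1 = "treatment_group T 1" and ?T0 = "treatment_group T 0"
  have "card ?T1 \<noteq> 0" using assms(1) by simp
  then have "(1 / real (card ?T1)) * (\<Sum>i\<in>?T1. k + c \<bullet> (S *v X i))
      = k + (1 / real (card ?T1)) * (\<Sum>i\<in>?T1. c \<bullet> (S *v X i))"
    by (simp add: sum.distrib distrib_left)
  moreover have "(\<Sum>i\<in>?T0. W i * (k + c \<bullet> (S *v X i)))
      = k + (\<Sum>i\<in>?T0. W i * (c \<bullet> (S *v X i)))"
    using assms(3) by (simp add: distrib_left sum.distrib sum_distrib_right[symmetric])
  moreover have "c \<bullet> (S *v mean_difference T X W)
      = (1 / real (card ?T1)) * (\<Sum>i\<in>?T1. c \<bullet> (S *v X i)) - (\<Sum>i\<in>?T0. W i * (c \<bullet> (S *v X i)))"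
    by (simp add: mean_difference_def inner_S inner_diff_right inner_sum_right)
  ultimately show ?thesis
    using assms(2) by (simp add: matching_error_def aff_def)
qed

text \<open>The error is the inner product of the slope with \<open>s\<close>. Cauchy-Schwarz for an
  almost optimal representation bounds it by \<open>norm s\<close>, and the function with intercept
  0 and slope \<open>sgn s\<close> attains this bound.\<close>

lemma error_dual_norm_affine:
  assumes "treatment_group T 1 \<noteq> {}" and "\<forall>i. X i \<in> D"
    and "(\<Sum>i\<in>treatment_group T 0. W i) = 1"
  shows "error_dual_norm (affine_functions V D) (affine_norm V D) T X W
    = ereal (mean_discrepancy V T X W)"
proof -
  note error = matching_error_aff[OF assms]
  define s where "s = S *v mean_difference T X W"
  have "error_dual_norm (affine_functions V D) (affine_norm V D) T X W = ereal (norm s)"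
    unfolding error_dual_norm_def
  proof (rule antisym)
    show "(SUP f\<in>{f \<in> affine_functions V D. affine_norm V D f \<le> 1}. ereal (matching_error T X W f))
        \<le> ereal (norm s)"
    proof (rule SUP_least)
      fix f assume "f \<in> {f \<in> affine_functions V D. affine_norm V D f \<le> 1}"
      then have f: "affine_norm V D f \<le> 1" by simp
      have "matching_error T X W f \<le> norm s + e" if "0 < e" for e
      proof -
        \<comment> \<open>The summand 1 keeps the denominator positive when \<open>s = 0\<close>,
          while \<open>\<delta> * norm s \<le> e\<close> still holds.\<close>
        define \<delta> where "\<delta> = e / (norm s + 1)"
        have "0 < norm s + 1" by (smt (verit) norm_ge_zero)
        then have \<delta>: "0 < \<delta>" "\<delta> * norm s \<le> e" using that by (simp_all add: \<delta>_def field_simps)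
        have "affine_norm V D f < ereal (1 + \<delta>)"
          using f \<delta>(1) by (simp add: le_less_trans one_ereal_def)
        then obtain p where p: "f = aff p" "norm p < 1 + \<delta>" by (rule affine_norm_lessE)
        have "matching_error T X W f = snd p \<bullet> s"
          using error[of "fst p" "snd p"] by (simp add: p s_def)
        also have "\<dots> \<le> norm (snd p) * norm s" by (rule norm_cauchy_schwarz)
        also have "\<dots> \<le> (1 + \<delta>) * norm s"
          using p(2) norm_snd_le[of "snd p" "fst p"] by (intro mult_right_mono) auto
        also have "\<dots> \<le> norm s + e" using \<delta>(2) by (simp add: distrib_right)
        finally show ?thesis .
      qed
      then show "ereal (matching_error T X W f) \<le> ereal (norm s)"
        by (simp add: field_le_epsilon)
    qed
    \<comment> \<open>The test slope is admissible because it is again an image under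
      \<open>S\<close>. For \<open>s = 0\<close> it is 0, which has norm at most 1 as well.\<close>
    have "sgn s = S *v (mean_difference T X W /\<^sub>R norm s)"
      by (simp add: sgn_div_norm s_def matrix_vector_mult_scaleR)
    then have coeffs: "(0, sgn s) \<in> coeffs" by (simp add: coeffs_def)
    have "affine_norm V D (aff (0, sgn s)) \<le> 1"
      using affine_norm_le[OF coeffs] by (auto intro: order_trans simp: norm_Pair norm_sgn)
    moreover have "matching_error T X W (aff (0, sgn s)) = norm s"
      unfolding error s_def[symmetric]
      by (cases "s = 0") (simp_all add: sgn_div_norm power2_norm_eq_inner[symmetric] power2_eq_square)
    ultimately show "ereal (norm s)
        \<le> (SUP f\<in>{f \<in> affine_functions V D. affine_norm V D f \<le> 1}. ereal (matching_error T X W f))"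
      using coeffs by (intro SUP_upper2[of "aff (0, sgn s)"]) (auto simp: affine_functions_eq)
  qed
  then show ?thesis by (simp add: mean_discrepancy_def mean_difference_def s_def)
qed

text \<open>In the slope coordinate the error of a class is the inner product with a fixed vector.
  Each class has a single error value, which makes \<open>the_elem\<close> meaningful.\<close>

lemma continuous_class_error:
  assumes "treatment_group T 1 \<noteq> {}" and "\<forall>i. X i \<in> D"
    and "(\<Sum>i\<in>treatment_group T 0. W i) = 1"
  shows "continuous_map (Metric_space.mtopology (mod_const D (affine_functions V D))
        (class_dist D (affine_functions V D) (affine_norm V D))) euclideanreal (class_error T X W)"
proof (rule slope_class_isometry(3))
  have "matching_error T X W ` slope_class g = {g \<bullet> (S *v mean_difference T X W)}" for g
    by (simp add: slope_class_def image_image matching_error_aff[OF assms])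
  then have "class_error T X W (slope_class g) = g \<bullet> (S *v mean_difference T X W)" for g
    by (simp add: class_error_def)
  then show "continuous_on diffs (\<lambda>g. class_error T X W (slope_class g))"
    by (simp add: continuous_intros)
qed

text \<open>On the allowable weights the dual norm equals the discrepancy, so both have the same
  minimizers. If every weight vector were a minimizer, no two discrepancies could differ, against
  \<open>not_const\<close>.\<close>

lemma EDNM_if_OMMS:
  assumes "treatment_group T 1 \<noteq> {}" and "\<forall>i. X i \<in> D"
    and sum: "\<And>W. W \<in> \<W> \<Longrightarrow> (\<Sum>i\<in>treatment_group T 0. W i) = 1"
    and \<W>: "\<W> = sample_weights m T ` \<S>"
    and not_const: "\<not> mean_discrepancy V T X constant_on (sample_weights m T ` \<S>)"
    and omms: "OMMS V m \<S> T X W"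
  shows "EDNM D (affine_functions V D) (affine_norm V D) \<W> T X W"
proof -
  let ?E = "error_dual_norm (affine_functions V D) (affine_norm V D) T X"
  have E: "?E W' = ereal (mean_discrepancy V T X W')" if "W' \<in> \<W>" for W'
    using error_dual_norm_affine[OF assms(1,2) sum[OF that]] .
  have minimizers: "minimizers ?E \<W> = minimizers (mean_discrepancy V T X) \<W>"
    using E by (auto simp: minimizers_def is_arg_min_def)
  have "minimizers (mean_discrepancy V T X) \<W> \<noteq> \<W>"
  proof
    assume "minimizers (mean_discrepancy V T X) \<W> = \<W>"
    then have "\<not> mean_discrepancy V T X W2 < mean_discrepancy V T X W1"
      if "W1 \<in> \<W>" "W2 \<in> \<W>" for W1 W2
      using that by (auto simp: minimizers_def is_arg_min_def)
    then have "mean_discrepancy V T X constant_on \<W>"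
      unfolding constant_on_def by (metis linorder_neqE)
    with not_const \<W> show False by simp
  qed
  with omms show ?thesis
    unfolding EDNM_def banach_mod_const_def OMMS_def minimizers \<W>[symmetric]
    using function_space_affine seminorm_affine slope_class_isometry(1,2)
      continuous_class_error[OF assms(1,2) sum]
    by blast
qed

end


section \<open>Weights of samples\<close>

lemma sum_count_eq_size:
  assumes "finite A" "set_mset K \<subseteq> A"
  shows "(\<Sum>i\<in>A. count K i) = size K"
  unfolding size_multiset_overloaded_eq
  using assms by (intro sum.mono_neutral_right) (auto simp: not_in_iff)

lemma sum_allowable_weights:
  assumes "W \<in> allowable_weights T W0" "W0 \<subseteq> prob_weights (treatment_group T 0)"
  shows "(\<Sum>i\<in>treatment_group T 0. W i) = 1"
proof -
  have "(\<Sum>i\<in>treatment_group T 0. restrict W (treatment_group T 0) i) = 1"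
    using assms by (auto simp: allowable_weights_def prob_weights_def)
  then show ?thesis by simp
qed

text \<open>A binary \<open>T\<close> places every subject in one of the two groups, so the values
  there determine the whole weight vector.\<close>

lemma sample_weights_eqI:
  assumes T: "\<forall>i. T i \<in> {0, 1}"
    and "\<And>i. i \<in> treatment_group T 1 \<Longrightarrow> W i = 1 / real (card (treatment_group T 1))"
    and "\<And>i. i \<in> treatment_group T 0 \<Longrightarrow> W i = real (count K i) / real m"
  shows "W = sample_weights m T K"
proof
  fix i
  have "i \<in> treatment_group T 0 \<or> i \<in> treatment_group T 1" using T by (auto simp: treatment_group_def)
  then show "W i = sample_weights m T K i"
    using assms(2,3) by (auto simp: sample_weights_def treatment_group_def)
qed

lemma sample_weights_in_multisubset:
  assumes "1 \<le> m" "K \<in> samples_with_replacement m T"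
  shows "sample_weights m T K \<in> allowable_weights T (multisubset_weights m (treatment_group T 0))"
proof -
  have K: "(\<Sum>i\<in>treatment_group T 0. count K i) = m"
    using assms(2) by (auto simp: samples_with_replacement_def sum_count_eq_size)
  have control: "sample_weights m T K i = real (count K i) / real m" if "i \<in> treatment_group T 0" for i
    using that by (simp add: sample_weights_def treatment_group_def)
  have "(\<Sum>i\<in>treatment_group T 0. real (count K i) / real m) = 1"
    unfolding sum_divide_distrib[symmetric] of_nat_sum[symmetric] K using assms(1) by simp
  then show ?thesis
    by (auto simp: allowable_weights_def multisubset_weights_def prob_weights_def control)
      (simp add: sample_weights_def)
qed

text \<open>This identifies the domain over which EDNM minimizes with the one over which OMMS
  minimizes. A sample is recovered from its weights by reading the numerators over \<open>m\<close>
  as multiplicities; total weight 1 means sample size \<open>m\<close>.\<close>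

lemma allowable_multisubset_weights:
  assumes T: "\<forall>i. T i \<in> {0, 1}" and m: "1 \<le> m"
  shows "allowable_weights T (multisubset_weights m (treatment_group T 0))
    = sample_weights m T ` samples_with_replacement m T"
proof
  let ?T0 = "treatment_group T 0"
  show "allowable_weights T (multisubset_weights m ?T0) \<subseteq> sample_weights m T ` samples_with_replacement m T"
  proof
    fix W assume W: "W \<in> allowable_weights T (multisubset_weights m ?T0)"
    then have "\<forall>i\<in>?T0. \<exists>k. W i = real k / real m"
      by (force simp: allowable_weights_def multisubset_weights_def PiE_iff)
    then obtain k where k: "\<And>i. i \<in> ?T0 \<Longrightarrow> W i = real (k i) / real m" by metis
    define K where "K = (\<Sum>i\<in>?T0. replicate_mset (k i) i)"
    have count: "count K i = (if i \<in> ?T0 then k i else 0)" for i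
      by (simp add: K_def count_sum)
    have "(\<Sum>i\<in>?T0. W i) = 1"
      using W by (rule sum_allowable_weights) (auto simp: multisubset_weights_def)
    then have "real (\<Sum>i\<in>?T0. k i) = real m"
      using m k by (simp add: sum_divide_distrib[symmetric])
    then have "(\<Sum>i\<in>?T0. k i) = m" by (simp only: of_nat_eq_iff)
    moreover have "set_mset K \<subseteq> ?T0"
      using count by (metis count_eq_zero_iff subsetI)
    moreover from this have "size K = (\<Sum>i\<in>?T0. k i)"
      using sum_count_eq_size[of ?T0 K] by (simp add: count)
    ultimately have "K \<in> samples_with_replacement m T"
      by (simp add: samples_with_replacement_def)
    moreover have "W = sample_weights m T K"
      using T by (rule sample_weights_eqI) (use W k count in \<open>auto simp: allowable_weights_def\<close>)
    ultimately show "W \<in> sample_weights m T ` samples_with_replacement m T" by blast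
  qed
qed (use m sample_weights_in_multisubset in blast)

text \<open>The sample is recovered as the support of the weights among the controls: each of its
  members has weight \<open>1 / m\<close>, so total weight 1 forces \<open>m\<close>
  members.\<close>

lemma allowable_subset_weights:
  assumes T: "\<forall>i. T i \<in> {0, 1}" and m: "1 \<le> m"
  shows "allowable_weights T (subset_weights m (treatment_group T 0))
    = sample_weights m T ` samples_without_replacement m T"
proof
  let ?T0 = "treatment_group T 0"
  show "allowable_weights T (subset_weights m ?T0) \<subseteq> sample_weights m T ` samples_without_replacement m T"
  proof
    fix W assume W: "W \<in> allowable_weights T (subset_weights m ?T0)"
    then have W_values: "W i = 0 \<or> W i = 1 / real m" if "i \<in> ?T0" for i
      using that by (force simp: allowable_weights_def subset_weights_def PiE_iff)
    define A where "A = {i \<in> ?T0. W i \<noteq> 0}"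
    have "(\<Sum>i\<in>?T0. W i) = 1"
      using W by (rule sum_allowable_weights) (auto simp: subset_weights_def)
    moreover have "(\<Sum>i\<in>?T0. W i) = (\<Sum>i\<in>A. 1 / real m)"
      using W_values by (intro sum.mono_neutral_cong_right) (auto simp: A_def)
    ultimately have "card A = m" using m by simp
    then have "mset_set A \<in> samples_without_replacement m T"
      by (auto simp: samples_without_replacement_def A_def)
    moreover have "W = sample_weights m T (mset_set A)"
      using T
    proof (rule sample_weights_eqI)
      show "W i = real (count (mset_set A) i) / real m" if "i \<in> ?T0" for i
        using that W_values by (auto simp: A_def count_mset_set')
    qed (use W in \<open>auto simp: allowable_weights_def\<close>)
    ultimately show "W \<in> sample_weights m T ` samples_without_replacement m T" by blast
  qed
  show "sample_weights m T ` samples_without_replacement m T \<subseteq> allowable_weights T (subset_weights m ?T0)"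
  proof
    fix W assume "W \<in> sample_weights m T ` samples_without_replacement m T"
    then obtain A where A: "A \<subseteq> ?T0" "card A = m" "W = sample_weights m T (mset_set A)"
      by (auto simp: samples_without_replacement_def)
    \<comment> \<open>A subset is a multisubset with multiplicities at most one, so beyond the
      previous case only the two possible weight values need checking.\<close>
    have "mset_set A \<in> samples_with_replacement m T"
      using A by (simp add: samples_with_replacement_def)
    then have "W \<in> allowable_weights T (multisubset_weights m ?T0)"
      using sample_weights_in_multisubset[OF m] A(3) by simp
    moreover have "W i \<in> {0, 1 / real m}" if "i \<in> ?T0" for i
      using that A by (auto simp: sample_weights_def count_mset_set' treatment_group_def)
    ultimately show "W \<in> allowable_weights T (subset_weights m ?T0)"
      by (auto simp: allowable_weights_def multisubset_weights_def subset_weights_def)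
  qed
qed

section \<open>Sampling with and without replacement as instances of one argument\<close>

theorem theorem5:
  fixes D :: "(real ^ 'd) set"
    and V :: "real ^ 'd ^ 'd"
    and m :: nat
    and T :: "'n::finite \<Rightarrow> nat"
    and X :: "'n \<Rightarrow> real ^ 'd"
    and W :: "'n \<Rightarrow> real"
  assumes "pos_semidef V"
    and "1 \<le> m"
    and "\<forall>i. T i \<in> {0, 1}"
    and "treatment_group T 0 \<noteq> {}" and "treatment_group T 1 \<noteq> {}"
    and "\<forall>i. X i \<in> D"
  shows "(\<not> mean_discrepancy V T X constant_on
              (sample_weights m T ` samples_with_replacement m T)
            \<and> OMMS V m (samples_with_replacement m T) T X W
          \<longrightarrow> EDNM D (affine_functions V D) (affine_norm V D)
                (allowable_weights T (multisubset_weights m (treatment_group T 0))) T X W)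
       \<and> (\<not> mean_discrepancy V T X constant_on
              (sample_weights m T ` samples_without_replacement m T)
            \<and> OMMS V m (samples_without_replacement m T) T X W
          \<longrightarrow> EDNM D (affine_functions V D) (affine_norm V D)
                (allowable_weights T (subset_weights m (treatment_group T 0))) T X W)"
proof -
  \<comment> \<open>\<open>D\<close> is nonempty because it contains the data points.\<close>
  interpret psd_affine V D
    using assms(1,6) by unfold_locales auto
  show ?thesis
  proof (intro conjI impI; elim conjE)
    have "(\<Sum>i\<in>treatment_group T 0. W i) = 1"
      if "W \<in> allowable_weights T (multisubset_weights m (treatment_group T 0))" for W
      using that by (rule sum_allowable_weights) (simp add: multisubset_weights_def)
    then show "EDNM D (affine_functions V D) (affine_norm V D)
        (allowable_weights T (multisubset_weights m (treatment_group T 0))) T X W"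
      if "\<not> mean_discrepancy V T X constant_on (sample_weights m T ` samples_with_replacement m T)"
        and "OMMS V m (samples_with_replacement m T) T X W"
      using EDNM_if_OMMS[OF assms(5,6) _ allowable_multisubset_weights[OF assms(3,2)] that] by blast
    have "(\<Sum>i\<in>treatment_group T 0. W i) = 1"
      if "W \<in> allowable_weights T (subset_weights m (treatment_group T 0))" for W
      using that by (rule sum_allowable_weights) (simp add: subset_weights_def)
    then show "EDNM D (affine_functions V D) (affine_norm V D)
        (allowable_weights T (subset_weights m (treatment_group T 0))) T X W"
      if "\<not> mean_discrepancy V T X constant_on (sample_weights m T ` samples_without_replacement m T)"
        and "OMMS V m (samples_without_replacement m T) T X W"
      using EDNM_if_OMMS[OF assms(5,6) _ allowable_subset_weights[OF assms(3,2)] that] by blast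
  qed
qed

end
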